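(* Let $G$ be a graph of connectivity $k$, let $Q$ be a spanning tree of $G$, and set $\mathfrak{S}:=\{V(e):\, e\in E(Q)\}$. Suppose that every $\mathfrak{S}$-fragment has cardinality at least $\frac{k-1}{2}$. Set $\mathfrak{R}:=\{V(e):\, e\in E(Q),\ |V(e)\cap A|=1 \text{ for some } \mathfrak{S}\text{-end } A\}$, and let $B$ be an $\mathfrak{R}$-end. Then at least one of the following holds: (1) $|B|=\frac{k-1}{2}$; (2) $Q$ contains a $k$-contractible edge with at least one endvertex in $B$; (3) $N_G(B)$ contains an $\mathfrak{R}$-fragment $C$ with $|C|=\frac{k-1}{2}$ such that every edge of $Q$ having exactly one endvertex in $C$ is $k$-contractible.
   Context: All graphs are finite, simple and undirected. $G$ is $k$-connected if $|V(G)|>k$ and $G-T$ is connected for all $T\subseteq V(G)$ with $|T|<k$; the connectivity $\kappa(G)$ is the largest such $k$. An edge $e$ of a $k$-connected graph is $k$-contractible if $G/e$ (identify the endvertices of $e$ and simplify) is $k$-connected. A smallest separating set is a $T\subseteq V(G)$ with $|T|=\kappa(G)$ and $G-T$ disconnected; $\mathfrak{T}(G)$ denotes the set of these. For $T\in\mathfrak{T}(G)$, a $T$-fragment is the union of the vertex sets of at least one but not all components of $G-T$. For a family $\mathfrak{S}$ of vertex subsets, a $T$-fragment $F$ is a $T$-$\mathfrak{S}$-fragment if $S\subseteq T$ for some $S\in\mathfrak{S}$; an $\mathfrak{S}$-fragment is a $T$-$\mathfrak{S}$-fragment for some $T\in\mathfrak{T}(G)$; an $\mathfrak{S}$-end is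 an $\mathfrak{S}$-fragment properly containing no other $\mathfrak{S}$-fragment. The same definitions apply with $\mathfrak{R}$ in place of $\mathfrak{S}$. *)

theory Defs
  imports Complex_Main
begin

record 'a graph =
  verts :: "'a set"
  edges :: "'a set set"

text \<open>An edge is the set of its two endvertices, so \<open>V(e)\<close> is \<open>e\<close> itself.\<close>

definition simple_graph :: "'a graph \<Rightarrow> bool" where
  "simple_graph G \<longleftrightarrow>
     finite (verts G) \<and> (\<forall>e\<in>edges G. e \<subseteq> verts G \<and> card e = 2)"

definition adj :: "'a graph \<Rightarrow> 'a \<Rightarrow> 'a \<Rightarrow> bool" where
  "adj G u v \<longleftrightarrow> {u, v} \<in> edges G"

definition reachable :: "'a graph \<Rightarrow> 'a \<Rightarrow> 'a \<Rightarrow> bool" where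
  "reachable G = (adj G)\<^sup>*\<^sup>*"

definition connected_graph :: "'a graph \<Rightarrow> bool" where
  "connected_graph G \<longleftrightarrow>
     verts G \<noteq> {} \<and> (\<forall>u\<in>verts G. \<forall>v\<in>verts G. reachable G u v)"

definition components :: "'a graph \<Rightarrow> 'a set set" where
  "components G = {{v \<in> verts G. reachable G u v} | u. u \<in> verts G}"

definition delete :: "'a graph \<Rightarrow> 'a set \<Rightarrow> 'a graph" where
  "delete G T = \<lparr>verts = verts G - T, edges = {e \<in> edges G. e \<inter> T = {}}\<rparr>"

definition nbhd :: "'a graph \<Rightarrow> 'a set \<Rightarrow> 'a set" where
  "nbhd G B = {v \<in> verts G - B. \<exists>u\<in>B. adj G u v}"

definition is_cycle :: "'a graph \<Rightarrow> 'a list \<Rightarrow> bool" where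
  "is_cycle G vs \<longleftrightarrow> 3 \<le> length vs \<and> distinct vs \<and> set vs \<subseteq> verts G \<and>
     successively (adj G) vs \<and> adj G (last vs) (hd vs)"

definition tree :: "'a graph \<Rightarrow> bool" where
  "tree G \<longleftrightarrow> connected_graph G \<and> (\<nexists>vs. is_cycle G vs)"

definition spanning_tree :: "'a graph \<Rightarrow> 'a graph \<Rightarrow> bool" where
  "spanning_tree Q G \<longleftrightarrow> verts Q = verts G \<and> edges Q \<subseteq> edges G \<and> tree Q"

definition k_connected :: "nat \<Rightarrow> 'a graph \<Rightarrow> bool" where
  "k_connected k G \<longleftrightarrow> card (verts G) > k \<and>
     (\<forall>T\<subseteq>verts G. card T < k \<longrightarrow> connected_graph (delete G T))"

text \<open>For a finite graph the set below is bounded by \<open>card (verts G)\<close>, and it contains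
  \<open>0\<close> unless the graph has no vertices; \<open>connectivity\<close> is unspecified for the
  graph without vertices.\<close>

definition connectivity :: "'a graph \<Rightarrow> nat" where
  "connectivity G = Max {k. k_connected k G}"

text \<open>The vertices of \<open>G/e\<close> are the classes of the partition of \<open>verts G\<close> into \<open>e\<close> and
  singletons. Dropping \<open>e\<close> removes the only loop that arises, and parallel edges coincide
  as sets.\<close>

definition contract_class :: "'a set \<Rightarrow> 'a \<Rightarrow> 'a set" where
  "contract_class e v = (if v \<in> e then e else {v})"

definition contract :: "'a graph \<Rightarrow> 'a set \<Rightarrow> 'a set graph" where
  "contract G e =
     \<lparr>verts = contract_class e ` verts G,
      edges = (\<lambda>d. contract_class e ` d) ` (edges G - {e})\<rparr>"

lemma simple_graph_contract:
  assumes "simple_graph G" "e \<in> edges G"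
  shows "simple_graph (contract G e)"
proof -
  have "card (contract_class e ` d) = 2" if "d \<in> edges G" "d \<noteq> e" for d
  proof -
    have d: "card d = 2" and e: "card e = 2"
      using assms that by (auto simp: simple_graph_def)
    have "\<not> d \<subseteq> e"
      using d e that(2) by (metis card_subset_eq card.infinite zero_neq_numeral)
    then have "inj_on (contract_class e) d"
      using d by (auto simp: inj_on_def contract_class_def card_2_iff)
    then show ?thesis
      using d by (simp add: card_image)
  qed
  then show ?thesis
    using assms by (auto simp: simple_graph_def contract_def)
qed

definition contractible :: "nat \<Rightarrow> 'a graph \<Rightarrow> 'a set \<Rightarrow> bool" where
  "contractible k G e \<longleftrightarrow> e \<in> edges G \<and> k_connected k (contract G e)"

definition smallest_separating_sets :: "'a graph \<Rightarrow> 'a set set" where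
  "smallest_separating_sets G =
     {T. T \<subseteq> verts G \<and> card T = connectivity G \<and> \<not> connected_graph (delete G T)}"

definition is_fragment :: "'a graph \<Rightarrow> 'a set \<Rightarrow> 'a set \<Rightarrow> bool" where
  "is_fragment G T F \<longleftrightarrow> T \<in> smallest_separating_sets G \<and>
     (\<exists>\<C>. \<C> \<noteq> {} \<and> \<C> \<subset> components (delete G T) \<and> F = \<Union>\<C>)"

definition family_fragment :: "'a graph \<Rightarrow> 'a set set \<Rightarrow> 'a set \<Rightarrow> bool" where
  "family_fragment G \<S> F \<longleftrightarrow> (\<exists>T. is_fragment G T F \<and> (\<exists>S\<in>\<S>. S \<subseteq> T))"

definition family_end :: "'a graph \<Rightarrow> 'a set set \<Rightarrow> 'a set \<Rightarrow> bool" where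
  "family_end G \<S> A \<longleftrightarrow>
     family_fragment G \<S> A \<and> \<not> (\<exists>F. family_fragment G \<S> F \<and> F \<subset> A)"

end

theory Submission
  imports Defs
begin

text \<open>
  Cross an end \<open>A\<close> with a fragment \<open>F\<close> whose neighbourhood \<open>N F\<close> meets \<open>A\<close> and contains a member of the
  family inside \<open>A \<union> N A\<close>. A corner of \<open>A\<close> that is itself a fragment would contradict minimality, and
  the lower bound \<open>(k - 1) / 2\<close> on fragments leaves only two outcomes. If \<open>N F\<close> meets \<open>N A\<close>, then
  \<open>A \<subseteq> N F\<close>, \<open>|A| = (k - 1) / 2\<close>, and the single vertex of \<open>N A \<inter> N F\<close> leaves \<open>(k - 1) / 2\<close> vertices of
  \<open>N A\<close> on each side of \<open>N F\<close>. Otherwise, if \<open>k\<close> is odd and \<open>|A| > (k - 1) / 2\<close>, one side of \<open>N F\<close> is a set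
  of \<open>(k - 1) / 2\<close> vertices contained in \<open>N A\<close>.

  Choose an \<open>\<SS>\<close>-end \<open>A \<subseteq> B\<close> and an edge \<open>xy\<close> of \<open>Q\<close> leaving \<open>A\<close>. If \<open>xy\<close> is not contractible, it lies
  in some \<open>N F\<close>, the first outcome for \<open>A\<close> gives \<open>A \<subseteq> N F\<close>, and crossing \<open>B\<close> with \<open>F\<close> gives
  \<open>|B| = (k - 1) / 2\<close> or a set \<open>C \<subseteq> N B\<close> with \<open>N C = N F\<close>. In the latter case, let \<open>zw\<close> be an edge of \<open>Q\<close>
  leaving \<open>C\<close> with \<open>zw \<subseteq> N F'\<close>. If \<open>w \<in> B\<close>, crossing \<open>B\<close> with \<open>F'\<close> gives \<open>|B| = (k - 1) / 2\<close>. If not, then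
  the connected set \<open>A \<union> {y}\<close> of \<open>(k + 1) / 2\<close> vertices of \<open>N C\<close> avoids \<open>N F'\<close>, so it lies on one side of
  \<open>N F'\<close>, where \<open>N C\<close> has only \<open>(k - 1) / 2\<close> vertices.
\<close>

section \<open>Reachability and vertex deletion\<close>

lemma rtranclp_stays:
  assumes "R\<^sup>*\<^sup>* u v" "u \<in> X" "\<And>x y. x \<in> X \<Longrightarrow> R x y \<Longrightarrow> y \<in> X"
  shows "v \<in> X"
  using assms by (induction rule: rtranclp_induct) auto

lemma adj_sym: "adj G u v \<Longrightarrow> adj G v u"
  by (simp add: adj_def insert_commute)

lemma reachable_sym: "reachable G u v \<Longrightarrow> reachable G v u"
  unfolding reachable_def
  by (metis adj_sym sympI sympD symp_rtranclp)

lemma adj_delete: "adj (delete G T) u v \<longleftrightarrow> adj G u v \<and> u \<notin> T \<and> v \<notin> T"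
  by (auto simp: adj_def delete_def)

lemma verts_delete [simp]: "verts (delete G T) = verts G - T"
  by (simp add: delete_def)

section \<open>Arithmetic of crossing an end with a fragment\<close>

text \<open>
  In the next two lemmas, \<open>a\<close>, \<open>t\<close>, \<open>b\<close> stand for the cardinalities of the parts of \<open>A\<close>, of \<open>N A\<close> and
  of the complement of \<open>A \<union> N A\<close>; the index 1, 2, 3 selects the part in \<open>F\<close>, in \<open>N F\<close>, or beyond.
\<close>

lemma cells_meet:
  fixes a1 :: nat
  assumes k: "k = t1 + t2 + t3" "k = a2 + t2 + b2"
    and A: "k \<le> 2 * a1 + 2 * a2 + 2 * a3 + 1" and B: "k \<le> 2 * b1 + 2 * b2 + 2 * b3 + 1"
    and F: "k \<le> 2 * a1 + 2 * t1 + 2 * b1 + 1" and F': "k \<le> 2 * a3 + 2 * t3 + 2 * b3 + 1"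
    and a1: "a1 = 0 \<or> k < a2 + t2 + t1" and a3: "a3 = 0 \<or> k < a2 + t2 + t3"
    and b1: "b1 = 0 \<or> k \<le> b2 + t2 + t1" and b3: "b3 = 0 \<or> k \<le> b2 + t2 + t3"
    and t2: "0 < t2"
  shows "a1 = 0 \<and> a3 = 0 \<and> 2 * a2 + 1 = k \<and> t2 = 1 \<and> 2 * t1 + 1 = k \<and> 2 * t3 + 1 = k"
proof -
  \<comment> \<open>Cancelling against each of the two expressions for \<open>k\<close> turns one
    corner inequality into two comparisons of single parts.\<close>
  have a1': "a1 = 0 \<or> b2 < t1 \<and> t3 < a2" and a3': "a3 = 0 \<or> b2 < t3 \<and> t1 < a2"
    and b1': "b1 = 0 \<or> t3 \<le> b2 \<and> a2 \<le> t1" and b3': "b3 = 0 \<or> t1 \<le> b2 \<and> a2 \<le> t3"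
    using k a1 a3 b1 b3 by auto
  \<comment> \<open>A nonzero \<open>a1\<close> excludes \<open>b3\<close>, because
    \<open>b2 < t1\<close> contradicts \<open>t1 \<le> b2\<close>. After that either two comparisons
    clash or the lower bounds overfill one of the two sums equal to \<open>k\<close>.\<close>
  have z1: "a1 = 0"
  proof (rule ccontr)
    assume "a1 \<noteq> 0"
    then have 1: "b2 < t1" "t3 < a2" "b3 = 0" using a1' b3' by auto
    show False using a3' b1'
      by (elim disjE conjE; use 1 k B F' t2 in linarith)
  qed
  have z3: "a3 = 0"
  proof (rule ccontr)
    assume "a3 \<noteq> 0"
    then have 1: "b2 < t3" "t1 < a2" "b1 = 0" using a3' b1' by auto
    show False using b3'
      by (elim disjE conjE; use 1 z1 k B F t2 in linarith)
  qed
  have 1: "k \<le> 2 * a2 + 1" using A z1 z3 by simp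
  have 2: "k \<le> 2 * t1 + 1" using b1' by (elim disjE conjE; use F z1 1 in linarith)
  have 3: "k \<le> 2 * t3 + 1" using b3' by (elim disjE conjE; use F' z3 1 in linarith)
  \<comment> \<open>Since \<open>t1\<close> and \<open>t3\<close> are at least
    \<open>(k - 1) / 2\<close> and \<open>t2\<close> is at least 1, the sum \<open>k\<close> leaves
    no slack.\<close>
  have 4: "t2 = 1" "2 * t1 + 1 = k" "2 * t3 + 1 = k" using 2 3 k t2 by linarith+
  have "2 * a2 + 1 \<le> k" using b1' b3' by (elim disjE conjE; use 4 B k in linarith)
  then show ?thesis using z1 z3 1 4 by simp
qed

lemma cells_disjoint:
  fixes a1 :: nat
  assumes k: "k = t1 + t3" "k = a2 + b2" "k = 2 * m + 1"
    and A: "k \<le> 2 * a1 + 2 * a2 + 2 * a3" and B: "k \<le> 2 * b1 + 2 * b2 + 2 * b3 + 1"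
    and F: "k \<le> 2 * a1 + 2 * t1 + 2 * b1 + 1" and F': "k \<le> 2 * a3 + 2 * t3 + 2 * b3 + 1"
    and a1: "a1 = 0 \<or> k < a2 + t1" and a3: "a3 = 0 \<or> k < a2 + t3"
    and b1: "b1 = 0 \<or> k \<le> b2 + t1" and b3: "b3 = 0 \<or> k \<le> b2 + t3"
  shows "(a1 = 0 \<and> b1 = 0 \<and> 2 * t1 + 1 = k \<and> 2 * a2 = k + 1) \<or>
    (a3 = 0 \<and> b3 = 0 \<and> 2 * t3 + 1 = k \<and> 2 * a2 = k + 1)"
proof -
  have a1': "a1 = 0 \<or> b2 < t1 \<and> t3 < a2" and a3': "a3 = 0 \<or> b2 < t3 \<and> t1 < a2"
    and b1': "b1 = 0 \<or> t3 \<le> b2 \<and> a2 \<le> t1" and b3': "b3 = 0 \<or> t1 \<le> b2 \<and> a2 \<le> t3"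
    using k(1,2) a1 a3 b1 b3 by auto
  show ?thesis
  \<comment> \<open>The first case makes \<open>F\<close> the small side, contained in
    \<open>N A\<close>. Every failure of it forces \<open>a3 = b3 = 0\<close> and
    \<open>t3 = m\<close> on the other side.\<close>
  proof (cases "a1 = 0 \<and> b1 = 0 \<and> t1 = m")
    case True
    then have T: "a1 = 0" "b1 = 0" "t1 = m" by auto
    have "m + 1 \<le> a2" using a3' by (elim disjE conjE; use T k A in linarith)
    moreover have "a2 \<le> m + 1" using b3' by (elim disjE conjE; use T k B in linarith)
    ultimately show ?thesis using T k by simp
  next
    case False
    then have T: "a1 \<noteq> 0 \<or> b1 \<noteq> 0 \<or> m < t1" using F k by linarith
    then have T': "b2 < t1 \<and> t3 < a2 \<or> b1 \<noteq> 0 \<and> t3 \<le> b2 \<and> a2 \<le> t1 \<or> a1 = 0 \<and> b1 = 0 \<and> m < t1"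
      using a1' b1' by auto
    have z3: "a3 = 0"
    proof (rule ccontr)
      assume "a3 \<noteq> 0"
      then have 1: "b2 < t3" "t1 < a2" "b1 = 0" using a3' b1' by auto
      show False using T' b3' a1'
        by (elim disjE conjE; use 1 k A B F F' in linarith)
    qed
    have z3': "b3 = 0"
    proof (rule ccontr)
      assume "b3 \<noteq> 0"
      then have 1: "t1 \<le> b2" "a2 \<le> t3" "a1 = 0" using b3' a1' by auto
      moreover have "m < a2" using 1 z3 k A by linarith
      ultimately show False using T'
        by (elim disjE conjE; use k in linarith)
    qed
    have t3: "m \<le> t3" using F' z3 z3' k by linarith
    have t3': "t3 \<le> m" using T' a1' b1'
      by (elim disjE conjE; use z3 z3' k A B F F' in linarith)
    have "m + 1 \<le> a2" using a1' by (elim disjE conjE; use z3 t3 k A in linarith)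
    moreover have "a2 \<le> m + 1" using b1' by (elim disjE conjE; use z3' t3 k B in linarith)
    ultimately show ?thesis using z3 z3' t3 t3' k by simp
  qed
qed

section \<open>Fragments and their complements\<close>

locale finite_graph_of_connectivity =
  fixes G :: "'a graph" and k :: nat
  assumes simple: "simple_graph G"
    and conn: "connectivity G = k"
    and nonempty: "verts G \<noteq> {}"
begin

abbreviation "V \<equiv> verts G"
abbreviation "N \<equiv> nbhd G"

text \<open>For a fragment \<open>F\<close> this is the complementary fragment, the union of the
  remaining components.\<close>

definition co :: "'a set \<Rightarrow> 'a set" where
  "co F = V - F - N F"

text \<open>Describes a fragment through its neighbourhood, which is then the separating set, so
  that components need not be handled; \<open>is_fragment_iff\<close> gives the equivalence.\<close>

definition frag :: "'a set \<Rightarrow> bool" where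
  "frag F \<longleftrightarrow> F \<subseteq> V \<and> F \<noteq> {} \<and> card (N F) = k \<and> co F \<noteq> {}"

lemma finite_V [simp]: "finite V"
  using simple by (simp add: simple_graph_def)

lemma finite_sub: "X \<subseteq> V \<Longrightarrow> finite X"
  by (rule finite_subset[OF _ finite_V])

lemma frag_finite: "frag F \<Longrightarrow> finite F"
  by (simp add: frag_def finite_sub)

lemma N_sub: "N F \<subseteq> V" "N F \<inter> F = {}"
  by (auto simp: nbhd_def)

lemma finite_N [simp]: "finite (N F)"
  using N_sub(1) by (rule finite_sub)

lemma adj_V: "adj G u v \<Longrightarrow> u \<in> V \<and> v \<in> V"
  using simple by (auto simp: simple_graph_def adj_def)

lemma edge_pair:
  assumes "e \<in> edges G"
  obtains u v where "e = {u, v}" "u \<noteq> v" "adj G u v"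
proof -
  have "card e = 2" using assms simple by (auto simp: simple_graph_def)
  then obtain u v where "e = {u, v}" "u \<noteq> v" by (auto simp: card_2_iff)
  then show thesis using that assms by (auto simp: adj_def)
qed

lemma adj_cases: "adj G u v \<Longrightarrow> u \<in> F \<Longrightarrow> v \<in> F \<or> v \<in> N F"
  using adj_V by (auto simp: nbhd_def)

lemma edge_leaving:
  assumes "e \<in> edges G" "card (e \<inter> F) = 1"
  obtains u v where "e = {u, v}" "adj G u v" "u \<in> F" "v \<in> N F"
proof -
  obtain u v where uv: "e = {u, v}" "u \<noteq> v" "adj G u v"
    using edge_pair[OF assms(1)] by metis
  have "\<not> (u \<in> F \<and> v \<in> F)" "u \<in> F \<or> v \<in> F"
    using assms(2) uv by (cases "u \<in> F"; cases "v \<in> F"; simp)+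
  then show thesis
    using that[of u v] that[of v u] uv adj_cases[of u v F] adj_cases[of v u F] adj_sym[of G u v]
    by (auto simp: insert_commute)
qed

lemma k_conn: "k_connected k G"
proof -
  have "j \<le> card V" if "k_connected j G" for j
    using that unfolding k_connected_def by linarith
  then have "{j. k_connected j G} \<subseteq> {..card V}" by blast
  then have "finite {j. k_connected j G}" by (rule finite_subset) simp
  moreover have "0 \<in> {j. k_connected j G}"
    using nonempty by (simp add: k_connected_def card_gt_0_iff)
  ultimately have "Max {j. k_connected j G} \<in> {j. k_connected j G}"
    by (metis Max_in emptyE)
  then show ?thesis using conn unfolding connectivity_def by blast
qed

text \<open>Every edge leaving \<open>F\<close> ends in \<open>N F\<close>, so deleting
  \<open>N F\<close> separates \<open>F\<close> from \<open>co F\<close>; fewer than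
  \<open>k\<close> vertices cannot do this.\<close>

lemma card_N_ge:
  assumes "F \<subseteq> V" "F \<noteq> {}" "co F \<noteq> {}"
  shows "k \<le> card (N F)"
proof (rule ccontr)
  assume "\<not> k \<le> card (N F)"
  then have c: "connected_graph (delete G (N F))"
    using k_conn N_sub(1) by (auto simp: k_connected_def)
  obtain u v where uv: "u \<in> F" "v \<in> co F" using assms by auto
  then have "reachable (delete G (N F)) u v"
    using c assms(1) N_sub by (fastforce simp: connected_graph_def co_def)
  then have "v \<in> F"
    unfolding reachable_def
    by (rule rtranclp_stays) (use uv adj_cases adj_delete in metis)+
  then show False using uv by (simp add: co_def)
qed

text \<open>No edge joins \<open>co F\<close> to \<open>F\<close>, so \<open>N (co F)\<close> lies
  in \<open>N F\<close>; the lower bound \<open>k\<close> from \<open>card_N_ge\<close> makes the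
  inclusion an equality.\<close>

lemma N_co:
  assumes "frag F"
  shows "N (co F) = N F" "co (co F) = F" "frag (co F)"
proof -
  have sub: "N (co F) \<subseteq> N F"
  proof
    fix v assume v: "v \<in> N (co F)"
    then obtain u where u: "u \<in> co F" "adj G u v" "v \<in> V" "v \<notin> co F"
      by (auto simp: nbhd_def)
    then show "v \<in> N F"
      using adj_cases[of v u F] adj_sym[OF u(2)] by (auto simp: co_def)
  qed
  have F: "F \<subseteq> V" "F \<noteq> {}" "card (N F) = k" "co F \<noteq> {}"
    using assms by (auto simp: frag_def)
  have "F \<subseteq> co (co F)"
    using sub F(1) N_sub(2) by (auto simp: co_def)
  then have "k \<le> card (N (co F))"
    using F by (intro card_N_ge) (auto simp: co_def)
  then show eq: "N (co F) = N F"
    using sub F(3) by (intro card_seteq) auto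
  show "co (co F) = F"
    using F(1) N_sub[of F] unfolding co_def[of "co F"] eq by (auto simp: co_def)
  then show "frag (co F)"
    using F eq by (auto simp: frag_def co_def)
qed

text \<open>A union of components has its neighbourhood inside \<open>T\<close>, and
  \<open>card_N_ge\<close> gives equality. Conversely, no edge of \<open>G\<close> without
  \<open>N F\<close> leaves \<open>F\<close>, so \<open>F\<close> is a union of components.\<close>

lemma is_fragment_iff: "is_fragment G T F \<longleftrightarrow> frag F \<and> N F = T"
proof
  assume "is_fragment G T F"
  then obtain \<C> where T: "T \<subseteq> V" "card T = k"
    and C: "\<C> \<noteq> {}" "\<C> \<subset> components (delete G T)" "F = \<Union>\<C>"
    using conn by (auto simp: is_fragment_def smallest_separating_sets_def)
  let ?H = "delete G T"
  have comp: "\<exists>u\<in>V - T. X = {v \<in> V - T. reachable ?H u v}" if "X \<in> components ?H" for X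
    using that by (auto simp: components_def)
  have closed: "w \<in> X" if "X \<in> components ?H" "v \<in> X" "reachable ?H v w" "w \<in> V - T" for X v w
    using comp[OF that(1)] that(2-) by (auto simp: reachable_def)
  have FT: "F \<subseteq> V - T" using C comp by fastforce
  have step: "w \<in> F" if "v \<in> F" "adj G v w" "w \<notin> T" for v w
  proof -
    have "v \<notin> T" "w \<in> V" using that FT adj_V by auto
    then have "reachable ?H v w"
      using that by (auto simp: reachable_def adj_delete)
    then show ?thesis
      using that \<open>w \<in> V\<close> C closed by blast
  qed
  then have NF: "N F \<subseteq> T" by (auto simp: nbhd_def)
  have ne: "X \<noteq> {}" if "X \<in> components ?H" for X
    using comp[OF that] by (auto simp: reachable_def)
  have Fne: "F \<noteq> {}" using C ne by fastforce
  \<comment> \<open>An omitted component supplies a vertex outside \<open>F\<close> and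
    \<open>T\<close>, so that \<open>co F\<close> is nonempty.\<close>
  obtain X where X: "X \<in> components ?H" "X \<notin> \<C>" using C by auto
  then obtain u where u: "u \<in> V - T" "X = {v \<in> V - T. reachable ?H u v}"
    using comp by blast
  have "u \<notin> F"
  proof
    assume "u \<in> F"
    then obtain Y where Y: "Y \<in> \<C>" "u \<in> Y" using C by auto
    then have Yc: "Y \<in> components ?H" using C by auto
    obtain y where y: "y \<in> V - T" "Y = {v \<in> V - T. reachable ?H y v}"
      using comp[OF Yc] by blast
    then have "reachable ?H y u" "reachable ?H u y" using Y reachable_sym by auto
    then have "Y = X" using y u by (auto simp: reachable_def)
    then show False using X Y by simp
  qed
  then have co: "co F \<noteq> {}" using u NF by (auto simp: co_def)
  then have "k \<le> card (N F)" using FT Fne by (intro card_N_ge) auto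
  then have "N F = T" using NF T(2) finite_sub[OF T(1)] by (intro card_seteq) auto
  then show "frag F \<and> N F = T" using FT Fne co T by (auto simp: frag_def)
next
  assume asm: "frag F \<and> N F = T"
  then have F: "F \<subseteq> V" "F \<noteq> {}" "card T = k" "co F \<noteq> {}" "N F = T"
    by (auto simp: frag_def)
  let ?H = "delete G T"
  have stay: "v \<in> F" if "reachable ?H u v" "u \<in> F" for u v
    using that(1) unfolding reachable_def
    by (rule rtranclp_stays) (use that F adj_cases adj_delete in metis)+
  let ?C = "(\<lambda>u. {v \<in> V - T. reachable ?H u v}) ` F"
  have FT: "F \<subseteq> V - T" using F N_sub by blast
  have U: "F = \<Union>?C"
    using FT stay by (auto simp: reachable_def)
  obtain w where w: "w \<in> co F" using F by auto
  then have wV: "w \<in> V - T" "w \<notin> F" using F by (auto simp: co_def)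
  have "{v \<in> V - T. reachable ?H w v} \<in> components ?H"
    using wV by (auto simp: components_def)
  moreover have "{v \<in> V - T. reachable ?H w v} \<notin> ?C"
    using U wV by (auto simp: reachable_def)
  moreover have "?C \<subseteq> components ?H"
    using FT by (auto simp: components_def)
  ultimately have C: "?C \<subset> components ?H" by blast
  obtain u where u: "u \<in> F" using F by auto
  have "\<not> reachable ?H u w" using stay u wV by blast
  then have "\<not> connected_graph ?H"
    using u wV FT by (auto simp: connected_graph_def)
  then have T: "T \<in> smallest_separating_sets G"
    using F N_sub conn by (auto simp: smallest_separating_sets_def)
  have "?C \<noteq> {}" using F(2) by simp
  then show "is_fragment G T F"
    unfolding is_fragment_def by (intro conjI exI[of _ ?C] T C U)
qed

lemma family_fragment_iff: "family_fragment G \<F> F \<longleftrightarrow> frag F \<and> (\<exists>S\<in>\<F>. S \<subseteq> N F)"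
  by (auto simp: family_fragment_def is_fragment_iff)

section \<open>Separating sets and noncontractible edges\<close>

lemma separating_set_fragment:
  assumes "T \<in> smallest_separating_sets G"
  obtains F where "frag F" "N F = T"
proof -
  let ?H = "delete G T"
  have T: "T \<subseteq> V" "card T = k" "\<not> connected_graph ?H"
    using assms conn by (auto simp: smallest_separating_sets_def)
  have "card T < card V" using T k_conn by (simp add: k_connected_def)
  then have "V - T \<noteq> {}" using T(1) by auto
  then obtain u v where uv: "u \<in> V - T" "v \<in> V - T" "\<not> reachable ?H u v"
    using T(3) by (auto simp: connected_graph_def)
  let ?K = "\<lambda>u. {v \<in> V - T. reachable ?H u v}"
  have "?K u \<in> components ?H" "?K v \<in> components ?H" "?K u \<noteq> ?K v"
    using uv by (auto simp: components_def reachable_def)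
  then have "{?K u} \<subset> components ?H" by blast
  then have "is_fragment G T (?K u)"
    unfolding is_fragment_def by (intro conjI exI[of _ "{?K u}"] assms) auto
  then show thesis using that is_fragment_iff by blast
qed

lemma card_split3:
  assumes "frag F" "X \<subseteq> V"
  shows "card X = card (X \<inter> F) + card (X \<inter> N F) + card (X \<inter> co F)"
proof -
  have fin: "finite X" using assms(2) by (rule finite_sub)
  have "X = (X \<inter> F) \<union> (X \<inter> N F) \<union> (X \<inter> co F)"
    using assms by (auto simp: co_def)
  also have "card \<dots> = card (X \<inter> F) + card (X \<inter> N F) + card (X \<inter> co F)"
    using N_sub(2)[of F] fin
    by (subst card_Un_disjoint; (subst card_Un_disjoint)?) (auto simp: co_def)
  finally show ?thesis .
qed

text \<open>A separating set of \<open>contract G e\<close> with fewer than \<open>k\<close>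
  vertices is pulled back to \<open>G\<close>. It gains at most one vertex, when the contracted
  vertex is replaced by both ends of \<open>e\<close>, so it is a smallest separating set containing
  \<open>e\<close>.\<close>

lemma noncontractible_edge:
  assumes e: "e \<in> edges G" and nc: "\<not> contractible k G e" and "frag F0"
  obtains F where "frag F" "e \<subseteq> N F"
proof -
  let ?c = "contract_class e"
  have eV: "e \<subseteq> V" "card e = 2" using e simple by (auto simp: simple_graph_def)
  then have fe: "finite e" using card.infinite by fastforce
  have cc: "?c v = e \<longleftrightarrow> v \<in> e" for v
    using eV by (auto simp: contract_class_def)
  have inj: "inj_on ?c (X - e)" for X
    by (auto simp: inj_on_def contract_class_def)
  \<comment> \<open>Both \<open>F0\<close> and \<open>co F0\<close> have a vertex besides the
    \<open>k\<close> vertices of \<open>N F0\<close>. Hence \<open>contract G e\<close> keeps more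
    than \<open>k\<close> vertices and can only fail through a separating set.\<close>
  have "k + 2 \<le> card V"
  proof -
    have F0: "F0 \<subseteq> V" "F0 \<noteq> {}" "card (N F0) = k" "co F0 \<noteq> {}"
      using assms(3) by (auto simp: frag_def)
    have "V \<inter> F0 = F0" "V \<inter> N F0 = N F0" "V \<inter> co F0 = co F0"
      using F0 N_sub(1)[of F0] by (auto simp: co_def)
    then have "card V = card F0 + k + card (co F0)"
      using card_split3[OF assms(3), of V] F0(3) by simp
    moreover have "card F0 > 0" "card (co F0) > 0"
      using F0 frag_finite[OF assms(3)] by (auto simp: card_gt_0_iff co_def)
    ultimately show ?thesis by linarith
  qed
  moreover have "card (?c ` V) \<ge> card V - 1"
  proof -
    have "card (?c ` V) \<ge> card (insert e (?c ` (V - e)))"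
      using eV cc by (intro card_mono) (auto simp: image_iff card_2_iff)
    also have "card (insert e (?c ` (V - e))) = Suc (card (V - e))"
      using cc card_image[OF inj[of V]] by (subst card_insert_disjoint) auto
    also have "\<dots> = Suc (card V - 2)"
      using eV fe by (simp add: card_Diff_subset)
    finally show ?thesis by linarith
  qed
  ultimately have "card (verts (contract G e)) > k"
    by (simp add: contract_def)
  then obtain T' where T': "T' \<subseteq> ?c ` V" "card T' < k"
    "\<not> connected_graph (delete (contract G e) T')"
    using nc e by (auto simp: contractible_def k_connected_def contract_def)
  let ?T = "{v \<in> V. ?c v \<in> T'}"
  let ?H = "delete G ?T" and ?H' = "delete (contract G e) T'"
  have fT': "finite T'" using T'(1) by (rule finite_subset) simp
  have nconn: "\<not> connected_graph ?H"
  proof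
    assume c: "connected_graph ?H"
    have step: "reachable ?H' (?c u) (?c v)" if "adj ?H u v" for u v
    proof (cases "{u, v} = e")
      case True
      then have "?c u = ?c v" by (auto simp: contract_class_def)
      then show ?thesis by (simp add: reachable_def)
    next
      case False
      have uv: "{u, v} \<in> edges G" "?c u \<notin> T'" "?c v \<notin> T'"
        using that[unfolded adj_delete] adj_V[of u v] unfolding adj_def by blast+
      then have "adj ?H' (?c u) (?c v)"
        using False by (auto simp: adj_def delete_def contract_def intro!: image_eqI[of _ _ "{u, v}"])
      then show ?thesis by (simp add: reachable_def)
    qed
    have lift: "reachable ?H' (?c u) (?c v)" if "reachable ?H u v" for u v
      using that unfolding reachable_def
      by (induction rule: rtranclp_induct)
        (use step in \<open>auto simp: reachable_def intro: rtranclp_trans\<close>)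
    have vs: "verts ?H' = ?c ` (V - ?T)" by (auto simp: contract_def)
    have "connected_graph ?H'"
      using c lift unfolding connected_graph_def vs by auto
    then show False using T'(3) by simp
  qed
  have "?T \<subseteq> V" by blast
  then have ge: "k \<le> card ?T"
    using nconn k_conn unfolding k_connected_def by (meson not_le)
  have le: "card (?T - e) \<le> card (T' - {e})"
    by (rule card_inj_on_le[OF inj]) (use fT' cc in auto)
  have split: "card ?T = card (?T - e) + card (?T \<inter> e)"
    using card_Diff_subset_Int[of ?T e] card_mono[of ?T "?T \<inter> e"] by simp
  \<comment> \<open>Without the contracted vertex, the preimage would be no larger than
    \<open>T'\<close>, yet it separates \<open>G\<close>.\<close>
  have eT': "e \<in> T'"
  proof (rule ccontr)
    assume "e \<notin> T'"
    then have "?T \<inter> e = {}" by (auto simp: contract_class_def)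
    then have "card ?T \<le> card T'" using split le \<open>e \<notin> T'\<close> by simp
    then show False using ge T'(2) by simp
  qed
  then have "e \<subseteq> ?T" using eV by (auto simp: contract_class_def)
  \<comment> \<open>The preimage has at most \<open>k - 2\<close> vertices outside \<open>e\<close>
    and at most 2 in it.\<close>
  moreover have "card (?T \<inter> e) \<le> 2" using card_mono[OF fe, of "?T \<inter> e"] eV by simp
  then have "card ?T = k"
    using split le ge T'(2) eT' fT' card_Diff_singleton[of e T'] card_gt_0_iff[of T']
    by auto
  then have "?T \<in> smallest_separating_sets G"
    using nconn conn by (simp add: smallest_separating_sets_def)
  ultimately show thesis
    using that separating_set_fragment by metis
qed

section \<open>Crossing fragments and ends\<close>

text \<open>The three cells counted by \<open>s\<close> are disjoint and cover
  \<open>N (A \<inter> F)\<close>, and \<open>co A\<close> lies beyond the corner, so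
  \<open>card_N_ge\<close> applies. If \<open>s \<le> k\<close>, the covering is an
  equality.\<close>

lemma corner:
  assumes A: "frag A" and F: "frag F" and ne: "A \<inter> F \<noteq> {}"
  defines "s \<equiv> card (A \<inter> N F) + card (N A \<inter> N F) + card (N A \<inter> F)"
  shows "k \<le> s"
    and "s \<le> k \<Longrightarrow> frag (A \<inter> F) \<and> N (A \<inter> F) = (A \<inter> N F) \<union> (N A \<inter> N F) \<union> (N A \<inter> F)"
proof -
  let ?W = "(A \<inter> N F) \<union> (N A \<inter> N F) \<union> (N A \<inter> F)"
  have fin: "finite A" using A by (rule frag_finite)
  have s: "s = card ?W"
    unfolding s_def using N_sub(2)[of A] N_sub(2)[of F] fin
    by (subst card_Un_disjoint; (subst card_Un_disjoint)?) auto
  have sub: "N (A \<inter> F) \<subseteq> ?W"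
  proof
    fix v assume "v \<in> N (A \<inter> F)"
    then obtain u where "u \<in> A" "u \<in> F" "adj G u v" "v \<notin> A \<inter> F"
      by (auto simp: nbhd_def)
    then show "v \<in> ?W" using adj_cases[of u v A] adj_cases[of u v F] by auto
  qed
  have "co A \<subseteq> co (A \<inter> F)" using sub by (auto simp: co_def)
  then have co: "co (A \<inter> F) \<noteq> {}" using A by (auto simp: frag_def)
  have AV: "A \<inter> F \<subseteq> V" using A by (auto simp: frag_def)
  have ge: "k \<le> card (N (A \<inter> F))" using card_N_ge[OF AV ne co] .
  have "card (N (A \<inter> F)) \<le> card ?W" using sub fin by (intro card_mono) auto
  then show "k \<le> s" using ge s by simp
  assume "s \<le> k"
  then have eq: "N (A \<inter> F) = ?W" using sub ge s fin by (intro card_seteq) auto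
  then have "card (N (A \<inter> F)) = k" using ge s \<open>s \<le> k\<close> by simp
  then show "frag (A \<inter> F) \<and> N (A \<inter> F) = ?W" using eq AV ne co by (simp add: frag_def)
qed

text \<open>Otherwise the corner would be a fragment with \<open>S\<close> in its neighbourhood,
  proper in \<open>A\<close> because \<open>A\<close> meets \<open>N F\<close>, against minimality
  of \<open>A\<close>.\<close>

lemma end_corner:
  assumes A: "family_end G \<F> A" and F: "frag F" and ne: "A \<inter> F \<noteq> {}"
    and S: "S \<in> \<F>" "S \<subseteq> N F" "S \<subseteq> A \<union> N A" and AT: "A \<inter> N F \<noteq> {}"
  shows "k < card (A \<inter> N F) + card (N A \<inter> N F) + card (N A \<inter> F)"
proof (rule ccontr)
  assume c: "\<not> ?thesis"
  have "frag A" using A by (simp add: family_end_def family_fragment_iff)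
  with corner(2)[OF this F ne] c
  have "frag (A \<inter> F)" "S \<subseteq> N (A \<inter> F)" using S by auto
  then have "family_fragment G \<F> (A \<inter> F)" using S by (auto simp: family_fragment_iff)
  moreover have "A \<inter> F \<subset> A" using AT N_sub(2)[of F] by blast
  ultimately show False using A by (auto simp: family_end_def)
qed

text \<open>The sets \<open>A\<close>, \<open>N A\<close>, \<open>co A\<close> and \<open>F\<close>,
  \<open>N F\<close>, \<open>co F\<close> cut \<open>V\<close> into nine cells; the two claims come
  from \<open>cells_meet\<close> and \<open>cells_disjoint\<close> applied to the cell
  sizes.\<close>

lemma end_crossing:
  assumes A: "family_end G \<F> A" and F: "frag F"
    and S: "S \<in> \<F>" "S \<subseteq> N F" "S \<subseteq> A \<union> N A" and AT: "A \<inter> N F \<noteq> {}"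
    and big: "\<And>X. family_fragment G \<F> X \<Longrightarrow> k \<le> 2 * card X + 1"
  shows "N A \<inter> N F \<noteq> {} \<Longrightarrow> A \<subseteq> N F \<and> 2 * card A + 1 = k \<and> card (N A \<inter> N F) = 1
      \<and> 2 * card (N A \<inter> F) + 1 = k \<and> 2 * card (N A \<inter> co F) + 1 = k"
    and "N A \<inter> N F = {} \<Longrightarrow> odd k \<Longrightarrow> k < 2 * card A + 1 \<Longrightarrow>
      \<exists>C\<in>{F, co F}. C \<subseteq> N A \<and> 2 * card C + 1 = k \<and> 2 * card (A \<inter> N F) = k + 1"
proof -
  have fA: "frag A" "family_fragment G \<F> A"
    using A by (auto simp: family_end_def family_fragment_iff)
  have AV: "A \<subseteq> V" "card (N A) = k" and FV: "F \<subseteq> V" "card (N F) = k"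
    using fA F by (auto simp: frag_def)
  have fin: "finite A" "finite F" using AV(1) FV(1) finite_sub by blast+
  have coV: "co A \<subseteq> V" "co F \<subseteq> V" by (auto simp: co_def)
  have fin': "finite (co A)" "finite (co F)" using coV finite_sub by blast+
  note c = N_co[OF fA(1)] N_co[OF F]
  have eA: "card A = card (A \<inter> F) + card (A \<inter> N F) + card (A \<inter> co F)"
    and eT: "k = card (N A \<inter> F) + card (N A \<inter> N F) + card (N A \<inter> co F)"
    and eB: "card (co A) = card (co A \<inter> F) + card (co A \<inter> N F) + card (co A \<inter> co F)"
    using card_split3[OF F] AV coV N_sub(1)[of A] by metis+
  have fF: "card F = card (A \<inter> F) + card (N A \<inter> F) + card (co A \<inter> F)"
    and fT: "k = card (A \<inter> N F) + card (N A \<inter> N F) + card (co A \<inter> N F)"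
    and fB: "card (co F) = card (A \<inter> co F) + card (N A \<inter> co F) + card (co A \<inter> co F)"
    using card_split3[OF fA(1)] FV coV N_sub(1)[of F] by (metis Int_commute)+
  \<comment> \<open>Complementary fragments share their neighbourhood, so the size bound holds for
    \<open>co A\<close> and for both sides of \<open>N F\<close>.\<close>
  have fam: "family_fragment G \<F> (co A)" "family_fragment G \<F> F" "family_fragment G \<F> (co F)"
    using fA c F S by (auto simp: family_fragment_iff)
  have gA: "k \<le> 2 * card (A \<inter> F) + 2 * card (A \<inter> N F) + 2 * card (A \<inter> co F) + 1"
    using big[OF fA(2)] unfolding eA by simp
  have gB: "k \<le> 2 * card (co A \<inter> F) + 2 * card (co A \<inter> N F) + 2 * card (co A \<inter> co F) + 1"
    using big[OF fam(1)] unfolding eB by simp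
  have gF: "k \<le> 2 * card (A \<inter> F) + 2 * card (N A \<inter> F) + 2 * card (co A \<inter> F) + 1"
    using big[OF fam(2)] unfolding fF by simp
  have gF': "k \<le> 2 * card (A \<inter> co F) + 2 * card (N A \<inter> co F) + 2 * card (co A \<inter> co F) + 1"
    using big[OF fam(3)] unfolding fB by simp
  \<comment> \<open>Corners of the end \<open>A\<close> satisfy a strict bound, those of
    \<open>co A\<close> only the weak one, since \<open>co A\<close> need not be an end.\<close>
  have a1: "card (A \<inter> F) = 0 \<or> k < card (A \<inter> N F) + card (N A \<inter> N F) + card (N A \<inter> F)"
    using end_corner[OF A F _ S AT] by (metis card.empty)
  have a3: "card (A \<inter> co F) = 0 \<or> k < card (A \<inter> N F) + card (N A \<inter> N F) + card (N A \<inter> co F)"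
    using end_corner[OF A c(6) _ S(1), unfolded c, OF _ S(2,3) AT] by (metis card.empty)
  have b1: "card (co A \<inter> F) = 0 \<or> k \<le> card (co A \<inter> N F) + card (N A \<inter> N F) + card (N A \<inter> F)"
    using corner(1)[OF c(3) F, unfolded c] by (metis card.empty)
  have b3: "card (co A \<inter> co F) = 0 \<or> k \<le> card (co A \<inter> N F) + card (N A \<inter> N F) + card (N A \<inter> co F)"
    using corner(1)[OF c(3) c(6), unfolded c] by (metis card.empty)
  { assume "N A \<inter> N F \<noteq> {}"
    then have t2: "0 < card (N A \<inter> N F)" by (simp add: card_gt_0_iff)
    note cells_meet[OF eT fT gA gB gF gF' a1 a3 b1 b3 t2]
    then have r: "card (A \<inter> F) = 0 \<and> card (A \<inter> co F) = 0 \<and> 2 * card A + 1 = k \<and> card (N A \<inter> N F) = 1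
      \<and> 2 * card (N A \<inter> F) + 1 = k \<and> 2 * card (N A \<inter> co F) + 1 = k"
      using eA by simp
    then have "A \<inter> F = {}" "A \<inter> co F = {}" using fin by auto
    then have "A \<subseteq> N F" using AV by (auto simp: co_def)
    with r show "A \<subseteq> N F \<and> 2 * card A + 1 = k \<and> card (N A \<inter> N F) = 1
      \<and> 2 * card (N A \<inter> F) + 1 = k \<and> 2 * card (N A \<inter> co F) + 1 = k" by blast }
  { assume d: "N A \<inter> N F = {}" and "odd k" and less: "k < 2 * card A + 1"
    then obtain m where m: "k = 2 * m + 1" by (auto elim: oddE)
    have t2: "card (N A \<inter> N F) = 0" using d by simp
    have sub: "X \<subseteq> N A" if "card (A \<inter> X) = 0" "card (co A \<inter> X) = 0" "X \<subseteq> V" for X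
    proof -
      have "A \<inter> X = {}" "co A \<inter> X = {}" using that fin fin' by auto
      then show ?thesis using that(3) by (auto simp: co_def)
    qed
    have eT': "k = card (N A \<inter> F) + card (N A \<inter> co F)" and fT': "k = card (A \<inter> N F) + card (co A \<inter> N F)"
      using eT fT t2 by simp_all
    have gA': "k \<le> 2 * card (A \<inter> F) + 2 * card (A \<inter> N F) + 2 * card (A \<inter> co F)"
      using less unfolding eA by simp
    have "(card (A \<inter> F) = 0 \<and> card (co A \<inter> F) = 0 \<and> 2 * card F + 1 = k \<and> 2 * card (A \<inter> N F) = k + 1)
      \<or> (card (A \<inter> co F) = 0 \<and> card (co A \<inter> co F) = 0 \<and> 2 * card (co F) + 1 = k \<and> 2 * card (A \<inter> N F) = k + 1)"
      using cells_disjoint[OF eT' fT' m gA' gB gF gF' a1[unfolded t2 add_0_right] a3[unfolded t2 add_0_right]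
          b1[unfolded t2 add_0_right] b3[unfolded t2 add_0_right]] fF fB
      by (elim disjE conjE; simp)
    then show "\<exists>C\<in>{F, co F}. C \<subseteq> N A \<and> 2 * card C + 1 = k \<and> 2 * card (A \<inter> N F) = k + 1"
      using sub FV coV by blast }
qed

text \<open>If \<open>A\<close> met both sides, \<open>A \<inter> F\<close> would have its
  neighbourhood inside \<open>N A\<close>, as no vertex of \<open>A\<close> lies in
  \<open>N F\<close>. By \<open>card_N_ge\<close> the two agree, giving a smaller family
  fragment.\<close>

lemma end_on_one_side:
  assumes A: "family_end G \<F> A" and F: "frag F" and d: "A \<inter> N F = {}"
  shows "A \<subseteq> F \<or> A \<subseteq> co F"
proof (rule ccontr)
  assume c: "\<not> ?thesis"
  have fA: "frag A" "family_fragment G \<F> A"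
    using A by (auto simp: family_end_def family_fragment_iff)
  then have AV: "A \<subseteq> V" "card (N A) = k" "co A \<noteq> {}" by (auto simp: frag_def)
  have ne: "A \<inter> F \<noteq> {}" and p: "A \<inter> F \<subset> A" using c d AV by (auto simp: co_def)
  have sub: "N (A \<inter> F) \<subseteq> N A"
  proof
    fix v assume "v \<in> N (A \<inter> F)"
    then obtain u where "u \<in> A" "u \<in> F" "adj G u v" "v \<notin> A \<inter> F"
      by (auto simp: nbhd_def)
    then show "v \<in> N A" using adj_cases[of u v A] adj_cases[of u v F] d by auto
  qed
  have "co A \<subseteq> co (A \<inter> F)" using sub by (auto simp: co_def)
  then have co: "co (A \<inter> F) \<noteq> {}" using AV by auto
  have "k \<le> card (N (A \<inter> F))" using AV ne co by (intro card_N_ge) auto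
  then have "N (A \<inter> F) = N A" using sub AV by (intro card_seteq) auto
  then have "family_fragment G \<F> (A \<inter> F)"
    using fA AV ne co by (auto simp: family_fragment_iff frag_def)
  then show False using A p by (auto simp: family_end_def)
qed

lemma exists_end:
  assumes "family_fragment G \<F> B"
  obtains A where "family_end G \<F> A" "A \<subseteq> B"
proof -
  have B: "frag B" using assms by (simp add: family_fragment_iff)
  then have "finite B" by (rule frag_finite)
  then have "finite {X. X \<subseteq> B \<and> family_fragment G \<F> X}" by auto
  then obtain A where "A \<in> {X. X \<subseteq> B \<and> family_fragment G \<F> X}"
    "\<forall>X\<in>{X. X \<subseteq> B \<and> family_fragment G \<F> X}. X \<subseteq> A \<longrightarrow> A = X"
    using finite_has_minimal[of "{X. X \<subseteq> B \<and> family_fragment G \<F> X}"] assms by auto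
  then have "family_end G \<F> A" "A \<subseteq> B" by (auto simp: family_end_def)
  then show thesis using that by blast
qed

end

section \<open>Ends for families of spanning tree edges\<close>

lemma connected_edge_leaving:
  assumes "connected_graph Q" "A \<subseteq> verts Q" "A \<noteq> {}" "A \<noteq> verts Q"
  obtains e where "e \<in> edges Q" "card (e \<inter> A) = 1"
proof -
  obtain u v where uv: "u \<in> A" "v \<in> verts Q" "v \<notin> A" using assms by auto
  then have r: "(adj Q)\<^sup>*\<^sup>* u v" using assms by (auto simp: connected_graph_def reachable_def)
  have "\<exists>x y. x \<in> A \<and> adj Q x y \<and> y \<notin> A"
    using rtranclp_stays[OF r uv(1)] uv(3) by blast
  then obtain x y where "x \<in> A" "{x, y} \<in> edges Q" "y \<notin> A" by (auto simp: adj_def)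
  then show thesis using that[of "{x, y}"] by simp
qed

theorem theorem8:
  fixes G Q :: "'a graph" and k :: nat and \<SS> \<RR> :: "'a set set" and B :: "'a set"
  assumes "simple_graph G"
    and "connectivity G = k"
    and "spanning_tree Q G"
    and "\<SS> = edges Q"
    and "\<And>F. family_fragment G \<SS> F \<Longrightarrow> real (card F) \<ge> (real k - 1) / 2"
    and "\<RR> = {e \<in> edges Q. \<exists>A. family_end G \<SS> A \<and> card (e \<inter> A) = 1}"
    and "family_end G \<RR> B"
  shows "real (card B) = (real k - 1) / 2
    \<or> (\<exists>e\<in>edges Q. contractible k G e \<and> e \<inter> B \<noteq> {})
    \<or> (\<exists>C. C \<subseteq> nbhd G B \<and> family_fragment G \<RR> C \<and> real (card C) = (real k - 1) / 2
          \<and> (\<forall>e\<in>edges Q. card (e \<inter> C) = 1 \<longrightarrow> contractible k G e))"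
proof -
  have Q: "connected_graph Q" "verts Q = verts G" "edges Q \<subseteq> edges G"
    using assms(3) by (auto simp: spanning_tree_def tree_def)
  interpret finite_graph_of_connectivity G k
    using assms(1,2) Q by unfold_locales (auto simp: connected_graph_def)
  have half: "real n = (real k - 1) / 2 \<longleftrightarrow> 2 * n + 1 = k" for n by (auto simp: field_simps)
  have bigS: "k \<le> 2 * card F + 1" if "family_fragment G \<SS> F" for F
    using assms(5)[OF that] by (simp add: field_simps)
  have RS: "\<RR> \<subseteq> \<SS>" using assms(4,6) by auto
  have bigR: "k \<le> 2 * card F + 1" if "family_fragment G \<RR> F" for F
    using that RS by (intro bigS) (auto simp: family_fragment_iff)
  have fB: "family_fragment G \<RR> B" "frag B"
    using assms(7) by (auto simp: family_end_def family_fragment_iff)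
  then have "family_fragment G \<SS> B" using RS by (auto simp: family_fragment_iff)
  then obtain A where A: "family_end G \<SS> A" "A \<subseteq> B" using exists_end by blast
  \<comment> \<open>Used for \<open>A\<close> and later for \<open>C\<close>: a noncontractible edge
    leaving the end \<open>X\<close> lies in some \<open>N F\<close>, which therefore meets both
    \<open>X\<close> and \<open>N X\<close>, so the first crossing outcome applies.\<close>
  have leave: "\<exists>u v F. e = {u, v} \<and> adj G u v \<and> u \<in> X \<and> v \<in> N X \<and> e \<in> \<RR> \<and> frag F \<and> e \<subseteq> N F
      \<and> X \<subseteq> N F \<and> 2 * card X + 1 = k \<and> card (N X \<inter> N F) = 1
      \<and> 2 * card (N X \<inter> F) + 1 = k \<and> 2 * card (N X \<inter> co F) + 1 = k"
    if X: "family_end G \<SS> X" and eQ: "e \<in> edges Q" "card (e \<inter> X) = 1"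
      and nc: "\<not> contractible k G e" for X e
  proof -
    have e: "e \<in> edges G" "e \<in> \<SS>" "e \<in> \<RR>" using X eQ Q assms(4,6) by auto
    obtain u v where uv: "e = {u, v}" "adj G u v" "u \<in> X" "v \<in> N X"
      using edge_leaving[OF e(1) eQ(2)] by metis
    obtain F where F: "frag F" "e \<subseteq> N F"
      using noncontractible_edge[OF e(1) nc fB(2)] by metis
    have "e \<subseteq> X \<union> N X" "X \<inter> N F \<noteq> {}" "N X \<inter> N F \<noteq> {}" using uv F by auto
    from end_crossing(1)[OF X F(1) e(2) F(2) this(1,2) bigS this(3)]
    show ?thesis using uv e(3) F by blast
  qed
  have fA: "frag A" using A by (auto simp: family_end_def family_fragment_iff)
  then have "A \<subseteq> verts Q" "A \<noteq> {}" "A \<noteq> verts Q" using Q by (auto simp: frag_def co_def)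
  then obtain e where e: "e \<in> edges Q" "card (e \<inter> A) = 1"
    using connected_edge_leaving[OF Q(1)] by metis
  show ?thesis
  proof (cases "2 * card B + 1 = k \<or> contractible k G e")
    case True
    moreover have "e \<inter> B \<noteq> {}" using e A by (metis card.empty inf_mono order_refl subset_empty zero_neq_one)
    ultimately show ?thesis using e half by blast
  next
    case False
    then have Bk: "2 * card B + 1 \<noteq> k" and nc: "\<not> contractible k G e" by auto
    obtain x y F where xy: "e = {x, y}" "adj G x y" "x \<in> A" "y \<in> N A" "e \<in> \<RR>"
      and F: "frag F" "e \<subseteq> N F" "A \<subseteq> N F" and Ak: "2 * card A + 1 = k"
      using leave[OF A(1) e nc] by metis
    have eB: "e \<subseteq> B \<union> N B" using xy A adj_cases[of x y B] by auto
    have BF: "B \<inter> N F \<noteq> {}" using xy F A by auto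
    note cross = end_crossing[OF assms(7) F(1) xy(5) F(2) eB BF bigR]
    \<comment> \<open>Otherwise the first outcome would give \<open>|B| = (k - 1) / 2\<close>, which
      \<open>Bk\<close> excludes. Since \<open>y\<close> is in \<open>N F\<close>, it must then lie
      in \<open>B\<close>.\<close>
    have d: "N B \<inter> N F = {}" using cross(1) Bk by blast
    then have yB: "y \<in> B" using eB F(2) xy by auto
    have "odd k" using Ak by auto
    moreover have "k < 2 * card B + 1" using bigR[OF fB(1)] Bk by simp
    ultimately obtain C where C: "C \<in> {F, co F}" "C \<subseteq> N B" "2 * card C + 1 = k"
      using cross(2)[OF _ d] by blast
    have C': "frag C" "N C = N F" using C(1) F N_co[OF F(1)] by auto
    have CR: "family_fragment G \<RR> C" using C' xy F by (auto simp: family_fragment_iff)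
    \<comment> \<open>A fragment attaining the lower bound cannot properly contain another one; this
      makes \<open>leave\<close> available for \<open>C\<close>.\<close>
    have Cend: "family_end G \<SS> C"
      unfolding family_end_def
    proof (intro conjI notI; (elim exE conjE)?)
      show "family_fragment G \<SS> C" using CR RS by (auto simp: family_fragment_iff)
      fix X assume X: "family_fragment G \<SS> X" "X \<subset> C"
      have "finite C" using C'(1) by (rule frag_finite)
      then have "card X < card C" using X psubset_card_mono by blast
      then show False using bigS[OF X(1)] C(3) by simp
    qed
    have "contractible k G f" if f: "f \<in> edges Q" "card (f \<inter> C) = 1" for f
    proof (rule ccontr)
      assume "\<not> contractible k G f"
      then obtain z w F' where zw: "f = {z, w}" "adj G z w" "z \<in> C" "w \<in> N C" "f \<in> \<RR>"
        and F': "frag F'" "f \<subseteq> N F'" "card (N C \<inter> N F') = 1"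
          "2 * card (N C \<inter> F') + 1 = k" "2 * card (N C \<inter> co F') + 1 = k"
        using leave[OF Cend f] by metis
      \<comment> \<open>The vertex \<open>z\<close> lies in \<open>C \<subseteq> N B\<close>, so
        with \<open>w\<close> in \<open>B\<close> the first crossing outcome would apply to
        \<open>B\<close> and \<open>F'\<close>.\<close>
      have "w \<notin> B"
      proof
        assume "w \<in> B"
        then have "f \<subseteq> B \<union> N B" "B \<inter> N F' \<noteq> {}" "N B \<inter> N F' \<noteq> {}"
          using zw F' C by auto
        then show False
          using end_crossing(1)[OF assms(7) F'(1) zw(5) F'(2) _ _ bigR] Bk by blast
      qed
      have "N C \<inter> N F' = {w}"
      proof -
        have "w \<in> N C \<inter> N F'" using zw F' by auto
        then show ?thesis using F'(3) by (metis card_1_singletonE singletonD)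
      qed
      \<comment> \<open>\<open>A\<close> and \<open>y\<close> lie in \<open>N F = N C\<close> and in
        \<open>B\<close>, whereas \<open>w\<close>, the only vertex of \<open>N C\<close> in
        \<open>N F'\<close>, is not in \<open>B\<close>.\<close>
      then have dis: "insert y A \<inter> N F' = {}"
        using \<open>w \<notin> B\<close> yB A F(2,3) xy C'(2) by auto
      \<comment> \<open>The edge \<open>xy\<close> keeps \<open>y\<close> on the side of
        \<open>N F'\<close> that contains \<open>A\<close>.\<close>
      have side: "insert y A \<subseteq> X \<inter> N C" if "A \<subseteq> X" "frag X" "N X = N F'" for X
        using that dis adj_cases[OF xy(2), of X] xy F C'(2) by auto
      have "card (insert y A) = Suc (card A)"
        using xy(4) N_sub(2)[of A] frag_finite[OF fA] by (auto simp: card_insert_if)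
      \<comment> \<open>\<open>insert y A\<close> has \<open>(k + 1) / 2\<close> vertices, one more
        than \<open>N C\<close> has on either side of \<open>N F'\<close>.\<close>
      then have small: "\<not> insert y A \<subseteq> X \<inter> N C" if "2 * card (N C \<inter> X) + 1 = k" for X
        using that Ak card_mono[of "X \<inter> N C" "insert y A"] by (auto simp: Int_commute)
      have "A \<inter> N F' = {}" using dis by blast
      from end_on_one_side[OF A(1) F'(1) this] show False
      proof
        assume "A \<subseteq> F'"
        then show False using side[OF _ F'(1) refl] small[OF F'(4)] by blast
      next
        assume "A \<subseteq> co F'"
        then show False using side N_co[OF F'(1)] small[OF F'(5)] by blast
      qed
    qed
    then show ?thesis
      using C(2) CR C(3)[folded half] by (intro disjI2 exI[of _ C]) simp
  qed
qed

end
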